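(* Let $G$ be a finite nilpotent group of order $n$ and let $H$ be a subgroup of $G$ of order $m$. Then $$\psi_H(G)\leq\psi_{H_m}(C_n),$$ where $C_n$ is the cyclic group of order $n$ and $H_m$ is the unique subgroup of order $m$ of $C_n$.
   Context: For a finite group $G$, a subgroup $H\leq G$ (not necessarily normal) and $x\in G$, the order of $x$ relative to $H$, denoted $o_H(x)$, is the smallest positive integer $r$ such that $x^r\in H$. Define $\psi_H(G)=\sum_{x\in G}o_H(x)$. *)

theory Defs
  imports "HOL-Algebra.Algebra"
begin

definition relative_order :: "('a, 'b) monoid_scheme \<Rightarrow> 'a set \<Rightarrow> 'a \<Rightarrow> nat"
  where "relative_order G H x = (LEAST r::nat. 0 < r \<and> x [^]\<^bsub>G\<^esub> r \<in> H)"

definition psi :: "('a, 'b) monoid_scheme \<Rightarrow> 'a set \<Rightarrow> nat"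
  where "psi G H = (\<Sum>x\<in>carrier G. relative_order G H x)"

primrec lower_central_series :: "('a, 'b) monoid_scheme \<Rightarrow> nat \<Rightarrow> 'a set"
  where
    "lower_central_series G 0 = carrier G"
  | "lower_central_series G (Suc i) =
       generate G (\<Union>x \<in> lower_central_series G i. \<Union>g \<in> carrier G.
         { x \<otimes>\<^bsub>G\<^esub> g \<otimes>\<^bsub>G\<^esub> inv\<^bsub>G\<^esub> x \<otimes>\<^bsub>G\<^esub> inv\<^bsub>G\<^esub> g })"

definition nilpotent :: "('a, 'b) monoid_scheme \<Rightarrow> bool"
  where "nilpotent G \<longleftrightarrow> (\<exists>k. lower_central_series G k = {\<one>\<^bsub>G\<^esub>})"

(* Meaningful when C is a finite cyclic group and m divides its order: there is then
   exactly one subgroup of order m. *)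
definition the_subgroup_of_order :: "('a, 'b) monoid_scheme \<Rightarrow> nat \<Rightarrow> 'a set"
  where "the_subgroup_of_order C m = (THE L. subgroup L C \<and> card L = m)"

end

theory Submission
  imports Defs
begin

text \<open>
The inequality is proved in a form that survives passing to factors of a direct product.  Instead of a
cyclic group \<open>C\<close>, take a finite commutative group in which, for every \<open>k > 0\<close>, at most \<open>k\<close> elements
satisfy \<open>x^k = 1\<close>; this condition passes to subgroups at once.  Then
\<open>psi_le_of_few_roots_of_unity\<close> compares a subgroup \<open>H\<close> of a nilpotent group \<open>G\<close> with a subgroup \<open>L\<close> of
\<open>C\<close>, where \<open>C\<close> has the order of \<open>G\<close> and \<open>L\<close> has the order of \<open>H\<close>.  The proof is by induction on the
order of \<open>G\<close>.

If this order is \<open>b * c\<close> with coprime \<open>b, c > 1\<close>, both groups split into a product of commuting subgroups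
of orders \<open>b\<close> and \<open>c\<close>, because elements of coprime orders commute in a nilpotent group
(\<open>nilpotent_coprime_commute\<close>) and Sylow subgroups can therefore be multiplied together
(\<open>coprime_decomposition\<close>).  Each component of an element is a power of that element, so every
subgroup splits along the product, the relative order of an element is the product of the relative
orders of its components, and the sum \<open>psi\<close> is multiplicative (\<open>psi_product\<close>).  The orders of the
two pieces of \<open>H\<close> are determined by the order of \<open>H\<close>, hence they agree with those of \<open>L\<close>, and the
induction hypothesis applies to each factor.

If the order is a power of a prime \<open>p\<close>, all relative orders are powers of \<open>p\<close>, and the elements of relative
order at most \<open>p^i\<close> are exactly those with \<open>x^(p^i) \<in> H\<close>.  In \<open>G\<close> there are many of them: by
\<open>p_group_extend_subgroup\<close> there is a chain of subgroups above \<open>H\<close>, each of index \<open>p\<close> in the next, in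
which \<open>p\<close>-th powers fall one step down; its \<open>i\<close>-th term gives \<open>p^i * |H|\<close> such elements, unless
the chain has reached \<open>G\<close>.  In \<open>C\<close> there are few: \<open>x^(p^i) \<in> L\<close> forces \<open>x\<close> to be a root of unity of
order dividing \<open>p^i * |L|\<close>, so there are at most that many.  Hence every tail of the distribution of relative orders is
at least as heavy in \<open>C\<close> as in \<open>G\<close>, and so is the sum.
\<close>

section \<open>Powers and relative orders\<close>

lemma subgroup_pow_card:
  fixes G (structure)
  assumes "group G" "finite (carrier G)" "subgroup K G" "x \<in> K"
  shows "x [^]\<^bsub>G\<^esub> card K = \<one>\<^bsub>G\<^esub>"
proof -
  interpret group G by fact
  interpret K: group "G\<lparr>carrier := K\<rparr>"
    using assms(3) by (rule subgroup_imp_group)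
  have "x [^]\<^bsub>G\<lparr>carrier := K\<rparr>\<^esub> order (G\<lparr>carrier := K\<rparr>) = \<one>\<^bsub>G\<lparr>carrier := K\<rparr>\<^esub>"
    by (rule K.pow_order_eq_1) (use assms in auto)
  then show ?thesis
    by (simp add: order_def nat_pow_consistent [symmetric])
qed

lemma subgroup_pow_closed:
  fixes G (structure)
  assumes "group G" "subgroup K G" "x \<in> K"
  shows "x [^]\<^bsub>G\<^esub> (k::nat) \<in> K"
  using assms by (induction k) (auto simp: subgroup.m_closed subgroup.one_closed group.is_monoid monoid.nat_pow_Suc monoid.nat_pow_0)

text \<open>
The exponents \<open>r\<close> with \<open>x^r \<in> H\<close> form a subgroup of the integers, and the relative order is its
positive generator.
\<close>

lemma relative_order_dvd_iff:
  fixes G (structure)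
  assumes "group G" "finite (carrier G)" "subgroup H G" "x \<in> carrier G"
  shows "0 < relative_order G H x" 
    and "x [^]\<^bsub>G\<^esub> (r::nat) \<in> H \<longleftrightarrow> relative_order G H x dvd r"
proof -
  interpret group G by fact
  interpret H: subgroup H G by fact
  let ?o = "relative_order G H x"
  \<comment> \<open>Some positive power of \<open>x\<close> lies in \<open>H\<close>, so the minimum that defines the relative order exists.\<close>
  have "0 < order G \<and> x [^] order G \<in> H"
    using assms by (simp add: pow_order_eq_1 order_gt_0_iff_finite)
  then have *: "0 < ?o \<and> x [^] ?o \<in> H"
    unfolding relative_order_def by (rule LeastI)
  then show "0 < ?o" by simp
  have closed: "x [^] (?o * k) \<in> H" for k
    using subgroup_pow_closed [OF assms(1,3), of "x [^] ?o" k] * assms(4)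
    by (simp add: nat_pow_pow)
  show "x [^] r \<in> H \<longleftrightarrow> ?o dvd r"
  proof
    assume "x [^] r \<in> H"
    moreover have eq: "x [^] r = x [^] (?o * (r div ?o)) \<otimes> x [^] (r mod ?o)"
      using assms(4) by (simp add: nat_pow_mult)
    ultimately have "x [^] (r mod ?o) \<in> H"
    proof -
      let ?u = "x [^] (?o * (r div ?o))" and ?v = "x [^] (r mod ?o)"
      assume "x [^] r \<in> H" "x [^] r = ?u \<otimes> ?v"
      then have "inv ?u \<otimes> (?u \<otimes> ?v) \<in> H"
        using closed [of "r div ?o"] by simp
      moreover have "inv ?u \<otimes> (?u \<otimes> ?v) = ?v"
        using assms(4) by (simp flip: m_assoc)
      ultimately show ?thesis by simp
    qed
    then have "\<not> 0 < r mod ?o"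
      using * not_less_Least [of "r mod ?o" "\<lambda>r. 0 < r \<and> x [^] r \<in> H"]
      by (metis mod_less_divisor relative_order_def)
    then show "?o dvd r"
      by (simp add: dvd_eq_mod_eq_0)
  next
    assume "?o dvd r"
    then show "x [^] r \<in> H"
      using closed by (auto simp: dvd_def)
  qed
qed

lemma relative_order_subgroup:
  assumes "monoid G"
  shows "relative_order (G\<lparr>carrier := K\<rparr>) H x = relative_order G H x"
  unfolding relative_order_def by (simp add: monoid.nat_pow_consistent [OF assms(1), symmetric])

lemma card_subgroup_dvd:
  assumes "group G" "subgroup I G" "subgroup K G" "I \<subseteq> K"
  shows "card I dvd card K"
proof -
  interpret group G by fact
  interpret K: group "G\<lparr>carrier := K\<rparr>"
    using assms(3) by (rule subgroup_imp_group)
  have "card (rcosets\<^bsub>G\<lparr>carrier := K\<rparr>\<^esub> I) * card I = card K"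
    using K.lagrange [OF subgroup_incl [OF assms(2-4)]] by (simp add: order_def)
  then show ?thesis
    by (rule dvdI [OF trans [OF sym mult.commute]])
qed

section \<open>Commuting subgroups of coprime orders\<close>

text \<open>
The setting of an internal direct product of two subgroups of coprime orders, except that the
product need not exhaust the group: Hall subgroups are built by multiplying such pairs together.
\<close>

locale coprime_commuting_subgroups = group G + P: subgroup P G + Q: subgroup Q G
  for G (structure) and P Q +
  assumes fin: "finite (carrier G)"
    and commute: "\<lbrakk>s \<in> P; t \<in> Q\<rbrakk> \<Longrightarrow> s \<otimes> t = t \<otimes> s"
    and coprime_card: "coprime (card P) (card Q)"
begin

lemma swap: "coprime_commuting_subgroups G Q P"
  by unfold_locales (use fin commute coprime_card in \<open>auto simp: ac_simps\<close>)

lemma finite_factors: "finite P" "finite Q"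
  using fin P.subset Q.subset finite_subset by auto

lemma pow_product:
  assumes "s \<in> P" "t \<in> Q"
  shows "(s \<otimes> t) [^] (k::nat) = s [^] k \<otimes> t [^] k"
  by (rule pow_mult_distrib) (use assms commute in auto)

text \<open>
By the Chinese remainder theorem some exponent is \<open>1\<close> modulo \<open>card P\<close> and \<open>0\<close> modulo \<open>card Q\<close>.  Raising
to this exponent projects a product onto its first factor.
\<close>

lemma component_is_power: "\<exists>e::nat. \<forall>s\<in>P. \<forall>t\<in>Q. (s \<otimes> t) [^] e = s"
proof -
  have "card Q \<noteq> 0"
    using subgroup.finite_imp_card_positive [OF Q.subgroup_axioms fin] by simp
  then obtain x y where xy: "card Q * x = card P * y + 1"
    using bezout_nat [of "card Q" "card P"] coprime_card
    by (metis coprime_commute coprime_imp_gcd_eq_1)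
  have "(s \<otimes> t) [^] (card Q * x) = s" if s: "s \<in> P" and t: "t \<in> Q" for s t
  proof -
    have "t [^] (card Q * x) = \<one>"
      using t subgroup_pow_card [OF is_group fin Q.subgroup_axioms t]
      by (simp flip: nat_pow_pow)
    moreover have "s [^] (card Q * x) = s"
      using s subgroup_pow_card [OF is_group fin P.subgroup_axioms s]
      by (simp add: xy flip: nat_pow_mult nat_pow_pow)
    ultimately show ?thesis
      using s t by (simp add: pow_product)
  qed
  then show ?thesis by blast
qed

text \<open>
A subgroup contains the powers of its elements, hence their components; this is why every subgroup
splits along the product.
\<close>

lemma component_mem:
  assumes "subgroup H G" "s \<in> P" "t \<in> Q"
  shows "s \<otimes> t \<in> H \<longleftrightarrow> s \<in> H \<and> t \<in> H"
proof
  assume st: "s \<otimes> t \<in> H"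
  interpret S: coprime_commuting_subgroups G Q P by (rule swap)
  from component_is_power assms obtain e :: nat where e: "(s \<otimes> t) [^] e = s" by blast
  from S.component_is_power assms obtain e' :: nat where e': "(t \<otimes> s) [^] e' = t" by blast
  show "s \<in> H \<and> t \<in> H"
    using subgroup_pow_closed [OF is_group assms(1) st, of e]
      subgroup_pow_closed [OF is_group assms(1) st, of e'] e e' commute [OF assms(2,3)]
    by simp
qed (use assms in \<open>auto simp: subgroup.m_closed\<close>)

lemma inj_product: "inj_on (\<lambda>(s, t). s \<otimes> t) (P \<times> Q)"
proof -
  obtain e :: nat where e: "\<forall>s\<in>P. \<forall>t\<in>Q. (s \<otimes> t) [^] e = s"
    using component_is_power by blast
  show ?thesis
  proof (rule inj_onI, clarify)
    fix s t s' t'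
    assume *: "s \<in> P" "t \<in> Q" "s' \<in> P" "t' \<in> Q" "s \<otimes> t = s' \<otimes> t'"
    then have "s = s'" using e by metis
    then show "s = s' \<and> t = t'" using * by simp
  qed
qed

lemma product_eq_image: "P <#> Q = (\<lambda>(s, t). s \<otimes> t) ` (P \<times> Q)"
  by (auto simp: set_mult_def)

lemma card_product: "card (P <#> Q) = card P * card Q"
  unfolding product_eq_image by (simp add: card_image [OF inj_product] card_cartesian_product)

lemma subgroup_product: "subgroup (P <#> Q) G"
proof (rule subgroupI)
  show "P <#> Q \<subseteq> carrier G"
    by (auto simp: set_mult_def)
  show "P <#> Q \<noteq> {}"
    using P.subgroup_axioms Q.subgroup_axioms subgroup.one_closed unfolding set_mult_def by blast
next
  fix a assume "a \<in> P <#> Q"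
  then obtain s t where st: "s \<in> P" "t \<in> Q" "a = s \<otimes> t"
    by (auto simp: set_mult_def)
  then have "inv a = inv s \<otimes> inv t"
    using commute [OF st(1,2)] by (simp add: inv_mult_group)
  then show "inv a \<in> P <#> Q"
    using st by (auto simp: set_mult_def)
next
  fix a b assume "a \<in> P <#> Q" "b \<in> P <#> Q"
  then obtain s t s' t' where st: "s \<in> P" "t \<in> Q" "a = s \<otimes> t" "s' \<in> P" "t' \<in> Q" "b = s' \<otimes> t'"
    by (auto simp: set_mult_def)
  have "a \<otimes> b = s \<otimes> (t \<otimes> s') \<otimes> t'"
    using st by (simp add: m_assoc)
  also have "\<dots> = (s \<otimes> s') \<otimes> (t \<otimes> t')"
    using st by (simp add: m_assoc flip: commute)
  finally show "a \<otimes> b \<in> P <#> Q"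
    using st by (auto simp: set_mult_def)
qed

text \<open>
A power of \<open>s \<otimes> t\<close> lies in \<open>H\<close> if and only if both component powers do, so the relative order is
the least common multiple of those of the components.  These divide \<open>card P\<close> and \<open>card Q\<close>, so they are
coprime and the least common multiple is their product.
\<close>

lemma relative_order_product:
  assumes H: "subgroup H G" and s: "s \<in> P" and t: "t \<in> Q"
  shows "relative_order G H (s \<otimes> t) = relative_order G (H \<inter> P) s * relative_order G (H \<inter> Q) t"
proof -
  have HP: "subgroup (H \<inter> P) G" and HQ: "subgroup (H \<inter> Q) G"
    using H P.subgroup_axioms Q.subgroup_axioms by (auto intro: subgroups_Inter_pair)
  note dvdP = relative_order_dvd_iff(2) [OF is_group fin HP P.mem_carrier [OF s]]
  note dvdQ = relative_order_dvd_iff(2) [OF is_group fin HQ Q.mem_carrier [OF t]]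
  have "relative_order G (H \<inter> P) s dvd card P"
    using subgroup_pow_card [OF is_group fin P.subgroup_axioms s] subgroup.one_closed [OF HP]
    by (simp flip: dvdP)
  moreover have "relative_order G (H \<inter> Q) t dvd card Q"
    using subgroup_pow_card [OF is_group fin Q.subgroup_axioms t] subgroup.one_closed [OF HQ]
    by (simp flip: dvdQ)
  ultimately have cop: "coprime (relative_order G (H \<inter> P) s) (relative_order G (H \<inter> Q) t)"
    using coprime_card coprime_divisors by blast
  have "relative_order G H (s \<otimes> t) dvd r \<longleftrightarrow>
      relative_order G (H \<inter> P) s * relative_order G (H \<inter> Q) t dvd r" for r
  proof -
    have sr: "s [^] r \<in> P" and tr: "t [^] r \<in> Q"
      using s t by (simp_all add: subgroup_pow_closed is_group P.subgroup_axioms Q.subgroup_axioms)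
    have "relative_order G H (s \<otimes> t) dvd r \<longleftrightarrow> s [^] r \<otimes> t [^] r \<in> H"
      using relative_order_dvd_iff(2) [OF is_group fin H, of "s \<otimes> t" r] s t
      by (simp add: pow_product)
    also have "\<dots> \<longleftrightarrow> s [^] r \<in> H \<inter> P \<and> t [^] r \<in> H \<inter> Q"
      using component_mem [OF H sr tr] sr tr by blast
    also have "\<dots> \<longleftrightarrow> relative_order G (H \<inter> P) s * relative_order G (H \<inter> Q) t dvd r"
      unfolding dvdP dvdQ using cop by (auto intro: divides_mult dest: dvd_mult_left dvd_mult_right)
    finally show ?thesis .
  qed
  then show ?thesis
    by (meson dvd_antisym dvd_refl)
qed

lemma psi_product:
  assumes H: "subgroup H G" and full: "P <#> Q = carrier G"
  shows "psi G H = psi (G\<lparr>carrier := P\<rparr>) (H \<inter> P) * psi (G\<lparr>carrier := Q\<rparr>) (H \<inter> Q)"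
proof -
  have "psi G H = (\<Sum>(s, t)\<in>P \<times> Q. relative_order G H (s \<otimes> t))"
    unfolding psi_def full [symmetric] product_eq_image
    by (subst sum.reindex [OF inj_product]) (simp add: case_prod_beta)
  also have "\<dots> = (\<Sum>(s, t)\<in>P \<times> Q. relative_order G (H \<inter> P) s * relative_order G (H \<inter> Q) t)"
    by (rule sum.cong) (auto simp: relative_order_product [OF H])
  also have "\<dots> = (\<Sum>s\<in>P. relative_order G (H \<inter> P) s) * (\<Sum>t\<in>Q. relative_order G (H \<inter> Q) t)"
    by (simp add: sum_product sum.cartesian_product)
  finally show ?thesis
    by (simp add: psi_def relative_order_subgroup is_monoid)
qed

lemma card_subgroup_product:
  assumes H: "subgroup H G" and full: "P <#> Q = carrier G"
  shows "card H = card (H \<inter> P) * card (H \<inter> Q)"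
proof -
  have "H = (\<lambda>(s, t). s \<otimes> t) ` ((H \<inter> P) \<times> (H \<inter> Q))"
  proof
    show "H \<subseteq> (\<lambda>(s, t). s \<otimes> t) ` ((H \<inter> P) \<times> (H \<inter> Q))"
    proof
      fix h assume h: "h \<in> H"
      then have "h \<in> P <#> Q"
        using subgroup.subset [OF H] full by blast
      then obtain s t where "s \<in> P" "t \<in> Q" "h = s \<otimes> t"
        by (auto simp: set_mult_def)
      then show "h \<in> (\<lambda>(s, t). s \<otimes> t) ` ((H \<inter> P) \<times> (H \<inter> Q))"
        using h component_mem [OF H] by force
    qed
  qed (use subgroup.m_closed [OF H] in auto)
  moreover have "inj_on (\<lambda>(s, t). s \<otimes> t) ((H \<inter> P) \<times> (H \<inter> Q))"
    by (rule inj_on_subset [OF inj_product]) auto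
  ultimately show ?thesis
    by (metis card_image card_cartesian_product)
qed

end

text \<open>
The exponents \<open>r\<close> and \<open>s\<close> stand for any multiples of the orders of \<open>x\<close> and \<open>y\<close>.  The condition covers
both nilpotent and commutative groups, so that one decomposition serves for the two groups to be
compared.
\<close>

definition coprime_orders_commute :: "('a, 'b) monoid_scheme \<Rightarrow> bool"
  where "coprime_orders_commute G \<longleftrightarrow> (\<forall>x\<in>carrier G. \<forall>y\<in>carrier G. \<forall>r s :: nat.
    coprime r s \<longrightarrow> x [^]\<^bsub>G\<^esub> r = \<one>\<^bsub>G\<^esub> \<longrightarrow> y [^]\<^bsub>G\<^esub> s = \<one>\<^bsub>G\<^esub> \<longrightarrow> x \<otimes>\<^bsub>G\<^esub> y = y \<otimes>\<^bsub>G\<^esub> x)"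

lemma coprime_commuting_subgroupsI:
  fixes G (structure)
  assumes "group G" "finite (carrier G)" "coprime_orders_commute G"
    and P: "subgroup P G" and Q: "subgroup Q G" and "coprime (card P) (card Q)"
  shows "coprime_commuting_subgroups G P Q"
proof -
  have "s \<otimes> t = t \<otimes> s" if "s \<in> P" "t \<in> Q" for s t
    using assms that subgroup_pow_card [OF assms(1,2) P that(1)] subgroup_pow_card [OF assms(1,2) Q that(2)]
    unfolding coprime_orders_commute_def by (meson subgroup.mem_carrier)
  then show ?thesis
    using assms unfolding coprime_commuting_subgroups_def coprime_commuting_subgroups_axioms_def by blast
qed

text \<open>
The subgroup is the product of Sylow subgroups for the primes dividing \<open>b\<close>, added one prime at a
time.  The product of the old subgroup and the next Sylow subgroup is again a subgroup because the two
commute elementwise.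
\<close>

lemma Hall_subgroup_exists:
  fixes G (structure)
  assumes "group G" "finite (carrier G)" "coprime_orders_commute G"
  shows "order G = b * c \<Longrightarrow> coprime b c \<Longrightarrow> \<exists>K. subgroup K G \<and> card K = b"
proof (induction b arbitrary: c rule: less_induct)
  case (less b)
  interpret group G by fact
  have "order G > 0"
    using assms(2) by (simp add: order_gt_0_iff_finite)
  then have "b > 0"
    using less.prems by (auto intro: Nat.gr0I)
  show ?case
  proof (cases "b = 1")
    case True
    then show ?thesis
      using triv_subgroup by (intro exI [of _ "{\<one>}"]) simp
  next
    case False
    then obtain p :: nat where p: "Factorial_Ring.prime p" "p dvd b"
      using prime_factor_nat by blast
    define a where "a = multiplicity p b"
    obtain b' where b': "b = p ^ a * b'" "\<not> p dvd b'"
      using multiplicity_decompose' [of b p] \<open>b > 0\<close> p unfolding a_def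
      by (metis neq0_conv not_prime_unit)
    have "a > 0"
      using p \<open>b > 0\<close> by (simp add: a_def prime_multiplicity_gt_zero_iff)
    then have "1 < p ^ a"
      using p prime_gt_1_nat one_less_power by blast
    then have "b' < b"
      using b' \<open>b > 0\<close> by auto
    have cop: "coprime (p ^ a) b'"
      using p b' by (simp add: prime_imp_coprime)
    have "coprime b' (p ^ a * c)"
      using less.prems(2) b' cop by (auto simp: ac_simps)
    with less.IH [OF \<open>b' < b\<close>, of "p ^ a * c"] obtain Q where Q: "subgroup Q G" "card Q = b'"
      using less.prems b' by (auto simp: ac_simps)
    obtain P where P: "subgroup P G" "card P = p ^ a"
      using sylow_thm [OF p(1) is_group, of a "b' * c"] less.prems(1) b' assms(2)
      by (auto simp: ac_simps)
    interpret coprime_commuting_subgroups G P Q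
      by (rule coprime_commuting_subgroupsI) (use assms P Q cop in auto)
    show ?thesis
      using subgroup_product card_product P Q b' by auto
  qed
qed

lemma coprime_decomposition:
  fixes G (structure)
  assumes "group G" "finite (carrier G)" "coprime_orders_commute G"
    and "order G = b * c" "coprime b c"
  obtains P Q where "coprime_commuting_subgroups G P Q" "P <#> Q = carrier G"
    "card P = b" "card Q = c"
proof -
  interpret group G by fact
  obtain P where P: "subgroup P G" "card P = b"
    using Hall_subgroup_exists [OF assms(1-3), of b c] assms by auto
  obtain Q where Q: "subgroup Q G" "card Q = c"
    using Hall_subgroup_exists [OF assms(1-3), of c b] assms by (auto simp: ac_simps)
  have PQ: "coprime_commuting_subgroups G P Q"
    by (rule coprime_commuting_subgroupsI) (use assms P Q in auto)
  interpret coprime_commuting_subgroups G P Q by (rule PQ)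
  have "P <#> Q = carrier G"
    by (rule card_subset_eq)
      (use assms P Q card_product subgroup.subset [OF subgroup_product] in \<open>auto simp: order_def\<close>)
  with PQ P Q that show ?thesis by blast
qed

section \<open>Nilpotent groups\<close>

text \<open>
The generators of each term are permuted by conjugation: the conjugate of a commutator is the
commutator of the conjugates, and the preceding term is normal.
\<close>

lemma lower_central_series_normal:
  fixes G (structure)
  assumes "group G"
  shows "lower_central_series G i \<lhd> G"
proof -
  interpret group G by fact
  show ?thesis
  proof (induction i)
    case 0
    show ?case
      by (rule normal_invI) (auto simp: subgroup_self)
  next
    case (Suc i)
    let ?L = "lower_central_series G i"
    interpret L: normal ?L G by (rule Suc)
    show ?case
      unfolding lower_central_series.simps
    proof (rule normal_generateI)
      show "(\<Union>x\<in>?L. \<Union>g\<in>carrier G. {x \<otimes> g \<otimes> inv x \<otimes> inv g}) \<subseteq> carrier G"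
        by auto
      fix h k
      assume "h \<in> (\<Union>x\<in>?L. \<Union>g\<in>carrier G. {x \<otimes> g \<otimes> inv x \<otimes> inv g})" and k: "k \<in> carrier G"
      then obtain x g where x: "x \<in> ?L" and g: "g \<in> carrier G" and h: "h = x \<otimes> g \<otimes> inv x \<otimes> inv g"
        by auto
      define x' g' where "x' = k \<otimes> x \<otimes> inv k" and "g' = k \<otimes> g \<otimes> inv k"
      have x': "x' \<in> ?L" and g': "g' \<in> carrier G"
        using x g k L.inv_op_closed2 by (auto simp: x'_def g'_def)
      have xc: "x \<in> carrier G" using x by auto
      have cancel: "inv k \<otimes> (k \<otimes> z) = z" if "z \<in> carrier G" for z
        using k that by (metis inv_closed l_inv l_one m_assoc)
      have "k \<otimes> h \<otimes> inv k = x' \<otimes> g' \<otimes> inv x' \<otimes> inv g'"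
        unfolding h x'_def g'_def using xc g k by (simp add: m_assoc inv_mult_group cancel)
      then show "k \<otimes> h \<otimes> inv k \<in> (\<Union>x\<in>?L. \<Union>g\<in>carrier G. {x \<otimes> g \<otimes> inv x \<otimes> inv g})"
        using x' g' by blast
    qed
  qed
qed

lemma commutator_in_lower_central_series:
  assumes "x \<in> lower_central_series G i" "g \<in> carrier G"
  shows "x \<otimes>\<^bsub>G\<^esub> g \<otimes>\<^bsub>G\<^esub> inv\<^bsub>G\<^esub> x \<otimes>\<^bsub>G\<^esub> inv\<^bsub>G\<^esub> g \<in> lower_central_series G (Suc i)"
  unfolding lower_central_series.simps by (rule generate.incl) (use assms in blast)

lemma lower_central_series_subgroup:
  fixes G (structure)
  assumes "group G" "subgroup K G"
  shows "lower_central_series (G\<lparr>carrier := K\<rparr>) i \<subseteq> lower_central_series G i"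
proof -
  interpret group G by fact
  interpret K: subgroup K G by fact
  interpret KG: group "G\<lparr>carrier := K\<rparr>"
    using assms(2) by (rule subgroup_imp_group)
  show ?thesis
  proof (induction i)
    case 0
    show ?case by (simp add: K.subset)
  next
    case (Suc i)
    let ?L = "lower_central_series (G\<lparr>carrier := K\<rparr>) i"
    have LK: "?L \<subseteq> K"
      using subgroup.subset [OF normal_imp_subgroup [OF lower_central_series_normal [OF KG.is_group, of i]]]
      by simp
    let ?A = "\<Union>x\<in>?L. \<Union>g\<in>K. {x \<otimes> g \<otimes> inv x \<otimes> inv g}"
    have eq: "(\<Union>x\<in>?L. \<Union>g\<in>carrier (G\<lparr>carrier := K\<rparr>). {x \<otimes>\<^bsub>G\<lparr>carrier := K\<rparr>\<^esub> g \<otimes>\<^bsub>G\<lparr>carrier := K\<rparr>\<^esub>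
        inv\<^bsub>G\<lparr>carrier := K\<rparr>\<^esub> x \<otimes>\<^bsub>G\<lparr>carrier := K\<rparr>\<^esub> inv\<^bsub>G\<lparr>carrier := K\<rparr>\<^esub> g}) = ?A"
      using LK by (intro SUP_cong) (auto simp: m_inv_consistent [OF assms(2)] subset_iff)
    have "?A \<subseteq> K"
      using LK by (auto simp: subset_iff)
    then have "lower_central_series (G\<lparr>carrier := K\<rparr>) (Suc i) = generate G ?A"
      unfolding lower_central_series.simps eq by (rule generate_consistent [OF _ assms(2)])
    also have "\<dots> \<subseteq> lower_central_series G (Suc i)"
      unfolding lower_central_series.simps
      by (rule mono_generate) (use Suc K.subset in blast)
    finally show ?case .
  qed
qed

lemma nilpotent_subgroup:
  fixes G (structure)
  assumes "group G" "nilpotent G" "subgroup K G"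
  shows "nilpotent (G\<lparr>carrier := K\<rparr>)"
proof -
  interpret group G by fact
  interpret KG: group "G\<lparr>carrier := K\<rparr>"
    using assms(3) by (rule subgroup_imp_group)
  obtain k where k: "lower_central_series G k = {\<one>}"
    using assms(2) by (auto simp: nilpotent_def)
  have "\<one>\<^bsub>G\<lparr>carrier := K\<rparr>\<^esub> \<in> lower_central_series (G\<lparr>carrier := K\<rparr>) k"
    using normal_imp_subgroup [OF lower_central_series_normal [OF KG.is_group, of k]]
    by (rule subgroup.one_closed)
  then show ?thesis
    using lower_central_series_subgroup [OF assms(1,3), of k] k
    unfolding nilpotent_def by (intro exI [of _ k]) auto
qed

text \<open>
If \<open>c = [x, y]\<close> commutes with \<open>x\<close> and \<open>y\<close>, then \<open>c \<otimes> y\<close> is a conjugate of \<open>y\<close>, and taking \<open>s\<close>-th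
powers gives \<open>c^s = 1\<close>.  Likewise \<open>c\<close> times a conjugate of \<open>x\<close> is \<open>x\<close>, which gives \<open>c^r = 1\<close>.
\<close>

lemma central_commutator_trivial:
  fixes G (structure)
  assumes "group G" and x: "x \<in> carrier G" and y: "y \<in> carrier G"
    and "x [^]\<^bsub>G\<^esub> (r::nat) = \<one>\<^bsub>G\<^esub>" "y [^]\<^bsub>G\<^esub> (s::nat) = \<one>\<^bsub>G\<^esub>" "coprime r s"
    and c: "c = x \<otimes>\<^bsub>G\<^esub> y \<otimes>\<^bsub>G\<^esub> inv\<^bsub>G\<^esub> x \<otimes>\<^bsub>G\<^esub> inv\<^bsub>G\<^esub> y"
    and cx: "c \<otimes>\<^bsub>G\<^esub> x = x \<otimes>\<^bsub>G\<^esub> c" and cy: "c \<otimes>\<^bsub>G\<^esub> y = y \<otimes>\<^bsub>G\<^esub> c"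
  shows "c = \<one>\<^bsub>G\<^esub>"
proof -
  interpret group G by fact
  have cc: "c \<in> carrier G" using c x y by simp
  have cancel: "inv y \<otimes> (y \<otimes> z) = z" "inv x \<otimes> (x \<otimes> z) = z" if "z \<in> carrier G" for z
    using x y that by (metis inv_closed l_inv l_one m_assoc)+
  have conj_pow: "(u \<otimes> v \<otimes> inv u) [^] k = u \<otimes> v [^] k \<otimes> inv u"
    if u: "u \<in> carrier G" and v: "v \<in> carrier G" for u v and k :: nat
  proof (induction k)
    case (Suc k)
    have "inv u \<otimes> (u \<otimes> z) = z" if "z \<in> carrier G" for z
      using u that by (metis inv_closed l_inv l_one m_assoc)
    then show ?case using Suc u v by (simp add: m_assoc)
  qed (use u in simp)
  have "c \<otimes> y = x \<otimes> y \<otimes> inv x"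
    unfolding c using x y by (simp add: m_assoc)
  then have "c [^] s \<otimes> y [^] s = x \<otimes> y [^] s \<otimes> inv x"
    using pow_mult_distrib [OF cy cc y, of s] conj_pow [OF x y] by simp
  then have cs: "c [^] s = \<one>"
    using assms cc by simp
  have "c \<otimes> (y \<otimes> x \<otimes> inv y) = x"
    unfolding c using x y by (simp add: m_assoc cancel)
  moreover have "c \<otimes> (y \<otimes> x \<otimes> inv y) = (y \<otimes> x \<otimes> inv y) \<otimes> c"
  proof -
    have "c \<otimes> inv y = inv y \<otimes> c"
      using cy cc y by (metis inv_closed inv_solve_left inv_solve_right m_assoc m_closed)
    then show ?thesis
      using cx cy cc x y by (metis inv_closed m_assoc m_closed)
  qed
  ultimately have "c [^] r \<otimes> (y \<otimes> x \<otimes> inv y) [^] r = x [^] r"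
    using pow_mult_distrib [of c "y \<otimes> x \<otimes> inv y" r] cc x y by simp
  then have cr: "c [^] r = \<one>"
    using conj_pow [OF y x, of r] assms cc by simp
  have "ord c dvd r" "ord c dvd s"
    using cs cr cc pow_eq_id by auto
  then have "ord c = 1"
    using coprime_common_divisor [OF assms(6), of "ord c"] by simp
  then show ?thesis
    using cc ord_eq_1 by auto
qed

text \<open>
The commutator \<open>c\<close> of \<open>x\<close> and \<open>y\<close> is pushed down the lower central series.  If it lies in one
term, its image modulo the next term \<open>N\<close> is central, so \<open>central_commutator_trivial\<close>, applied in
\<open>G Mod N\<close>, puts it into \<open>N\<close>.  The series ends in the trivial group.
\<close>

lemma nilpotent_coprime_commute:
  fixes G (structure)
  assumes "group G" "nilpotent G" and x: "x \<in> carrier G" and y: "y \<in> carrier G"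
    and xr: "x [^]\<^bsub>G\<^esub> (r::nat) = \<one>\<^bsub>G\<^esub>" and ys: "y [^]\<^bsub>G\<^esub> (s::nat) = \<one>\<^bsub>G\<^esub>" and "coprime r s"
  shows "x \<otimes>\<^bsub>G\<^esub> y = y \<otimes>\<^bsub>G\<^esub> x"
proof -
  interpret group G by fact
  define c where "c = x \<otimes> y \<otimes> inv x \<otimes> inv y"
  have cc: "c \<in> carrier G" using x y by (simp add: c_def)
  have "c \<in> lower_central_series G i" for i
  proof (induction i)
    case 0
    show ?case using cc by simp
  next
    case (Suc i)
    define N where "N = lower_central_series G (Suc i)"
    interpret N: normal N G unfolding N_def by (rule lower_central_series_normal [OF is_group])
    \<comment> \<open>\<open>Q\<close> is kept opaque: unfolding the quotient would replace its multiplication by the product of cosets.\<close>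
    define f Q where "f = (#>) N" and "Q = G Mod N"
    interpret f: group_hom G "Q" f
      unfolding f_def Q_def group_hom_def group_hom_axioms_def
      using N.factorgroup_is_group N.r_coset_hom_Mod is_group by auto
    have one_iff: "f z = \<one>\<^bsub>Q\<^esub> \<longleftrightarrow> z \<in> N" if "z \<in> carrier G" for z
      unfolding f_def Q_def one_FactGroup
      using that coset_join1 [OF _ that N.is_subgroup] coset_join2 [OF that N.is_subgroup] by blast
    have comm: "f c \<otimes>\<^bsub>Q\<^esub> f g = f g \<otimes>\<^bsub>Q\<^esub> f c" if g: "g \<in> carrier G" for g
    proof -
      have "c \<otimes> g \<otimes> inv c \<otimes> inv g \<in> N"
        unfolding N_def using Suc g by (rule commutator_in_lower_central_series)
      then have "f (c \<otimes> g \<otimes> inv c \<otimes> inv g) = \<one>\<^bsub>Q\<^esub>"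
        by (subst one_iff) (use g cc in auto)
      then have "f (c \<otimes> g \<otimes> inv c \<otimes> inv g) \<otimes>\<^bsub>Q\<^esub> (f (g \<otimes> c)) = f (g \<otimes> c)"
        using g cc by simp
      moreover have "c \<otimes> g \<otimes> inv c \<otimes> inv g \<otimes> (g \<otimes> c) = c \<otimes> g"
      proof -
        have "inv g \<otimes> (g \<otimes> c) = c"
          using g cc by (metis inv_closed l_inv l_one m_assoc)
        then show ?thesis using g cc by (simp add: m_assoc)
      qed
      ultimately show ?thesis
        using g cc by (simp flip: f.hom_mult)
    qed
    have "f c = \<one>\<^bsub>Q\<^esub>"
    proof (rule central_commutator_trivial [of _ "f x" "f y" r s])
      show "f x [^]\<^bsub>Q\<^esub> r = \<one>\<^bsub>Q\<^esub>" "f y [^]\<^bsub>Q\<^esub> s = \<one>\<^bsub>Q\<^esub>"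
        using xr ys x y by (simp_all flip: f.hom_nat_pow)
      show "f c = f x \<otimes>\<^bsub>Q\<^esub> f y \<otimes>\<^bsub>Q\<^esub> inv\<^bsub>Q\<^esub> f x \<otimes>\<^bsub>Q\<^esub> inv\<^bsub>Q\<^esub> f y"
        unfolding c_def using x y by simp
    qed (use assms x y comm f.H.is_group in auto)
    then show ?case
      using one_iff cc by (simp add: N_def)
  qed
  then have "c = \<one>"
    using assms(2) unfolding nilpotent_def by auto
  then have "x \<otimes> y \<otimes> inv x \<otimes> inv y \<otimes> (y \<otimes> x) = y \<otimes> x"
    using x y by (simp add: c_def)
  moreover have "inv y \<otimes> (y \<otimes> x) = x"
    using x y by (metis inv_closed l_inv l_one m_assoc)
  ultimately show ?thesis
    using x y by (simp add: m_assoc)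
qed

lemma nilpotent_coprime_orders_commute:
  "group G \<Longrightarrow> nilpotent G \<Longrightarrow> coprime_orders_commute G"
  unfolding coprime_orders_commute_def by (meson nilpotent_coprime_commute)

text \<open>
Let \<open>i\<close> be an index for which term \<open>i\<close> of the lower central series is not contained in \<open>H\<close> but the next one is.  An element \<open>g\<close> of
this term outside \<open>H\<close> normalizes \<open>H\<close>, because its commutators with elements of \<open>H\<close> lie in the next
term and therefore in \<open>H\<close>.
\<close>

lemma normalizer_grows:
  fixes G (structure)
  assumes "group G" "nilpotent G" and H: "subgroup H G" and "H \<noteq> carrier G"
  shows "\<exists>g\<in>carrier G - H. \<forall>h\<in>H. g \<otimes> h \<otimes> inv g \<in> H"
proof -
  interpret group G by fact
  interpret H: subgroup H G by (rule H)
  let ?P = "\<lambda>i. lower_central_series G i \<subseteq> H"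
  obtain k where "lower_central_series G k = {\<one>}"
    using assms(2) by (auto simp: nilpotent_def)
  then have "?P k" by simp
  moreover have "\<not> ?P 0"
    using assms(4) H.subset by auto
  ultimately obtain i where i: "\<not> ?P i" "?P (Suc i)"
    using nat_induct [of "\<lambda>i. \<not> ?P i" k] by blast
  then obtain g where g: "g \<in> lower_central_series G i" "g \<notin> H"
    by blast
  have gc: "g \<in> carrier G"
    using g subgroup.subset [OF normal_imp_subgroup [OF lower_central_series_normal [OF is_group]]]
    by blast
  have "g \<otimes> h \<otimes> inv g \<in> H" if h: "h \<in> H" for h
  proof -
    have "g \<otimes> h \<otimes> inv g \<otimes> inv h \<in> H"
      using commutator_in_lower_central_series [OF g(1), of h] h i by auto
    then have "g \<otimes> h \<otimes> inv g \<otimes> inv h \<otimes> h \<in> H"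
      using h by (rule H.m_closed)
    moreover have "g \<otimes> h \<otimes> inv g \<otimes> inv h \<otimes> h = g \<otimes> h \<otimes> inv g"
      using h gc by (simp add: m_assoc)
    ultimately show ?thesis by simp
  qed
  with g gc show ?thesis by blast
qed

section \<open>Roots in groups of prime power order\<close>

text \<open>
Start from an element \<open>f\<close> outside \<open>H\<close> that normalizes \<open>H\<close>.  Its relative order is \<open>p^e\<close> with
\<open>e > 0\<close>, so \<open>g = f^(p^(e-1))\<close> still normalizes \<open>H\<close> and has relative order exactly \<open>p\<close>.  The
subgroup generated by \<open>H\<close> and \<open>g\<close> is the disjoint union of the cosets \<open>H g^i\<close> for \<open>i < p\<close>, and modulo
\<open>H\<close> it is cyclic of order \<open>p\<close>.
\<close>

lemma p_group_extend_subgroup: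
  fixes G (structure) and p :: nat
  assumes "group G" "nilpotent G" "order G = p ^ a" "Factorial_Ring.prime p"
    and H: "subgroup H G" and "H \<noteq> carrier G"
  obtains K where "subgroup K G" "card K = p * card H" "\<And>x. x \<in> K \<Longrightarrow> x [^] p \<in> H"
proof -
  interpret group G by fact
  interpret H: subgroup H G by (rule H)
  have "p > 0" using assms(4) prime_gt_0_nat by blast
  then have "order G > 0" using assms(3) by simp
  then have fin: "finite (carrier G)" by (simp add: order_gt_0_iff_finite)
  obtain f where f: "f \<in> carrier G" "f \<notin> H" "\<And>h. h \<in> H \<Longrightarrow> f \<otimes> h \<otimes> inv f \<in> H"
    using normalizer_grows [OF assms(1,2,5,6)] by blast
  note ro = relative_order_dvd_iff(2) [OF is_group fin H]
  have "relative_order G H f dvd p ^ a"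
    using f pow_order_eq_1 [of f] assms(3) by (simp flip: ro)
  then obtain e where e: "relative_order G H f = p ^ e"
    using assms(4) divides_primepow_nat by blast
  have "e \<noteq> 0"
    using ro [of f 1] f e by (intro notI) simp
  define g where "g = f [^] (p ^ (e - 1))"
  have g: "g \<in> carrier G" using f by (simp add: g_def)
  have g_pow: "g [^] i \<in> H \<longleftrightarrow> p dvd i" for i :: nat
  proof -
    have "g [^] i \<in> H \<longleftrightarrow> p ^ e dvd p ^ (e - 1) * i"
      using ro [of f "p ^ (e - 1) * i"] f e by (simp add: g_def nat_pow_pow)
    also have "p ^ e = p ^ (e - 1) * p"
      using \<open>e \<noteq> 0\<close> by (metis power_minus_mult neq0_conv)
    finally show ?thesis
      using \<open>p > 0\<close> by simp
  qed
  have pow_norm: "f [^] i \<otimes> h \<otimes> inv (f [^] i) \<in> H" if "h \<in> H" for h and i :: nat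
    using that
  proof (induction i arbitrary: h)
    case (Suc i)
    have "f [^] Suc i \<otimes> h \<otimes> inv (f [^] Suc i) = f [^] i \<otimes> (f \<otimes> h \<otimes> inv f) \<otimes> inv (f [^] i)"
      using f Suc.prems by (simp add: m_assoc inv_mult_group)
    then show ?case
      using Suc f by simp
  qed simp
  have norm: "\<exists>h'\<in>H. g [^] i \<otimes> h = h' \<otimes> g [^] i" if h: "h \<in> H" for h and i :: nat
  proof
    show "g [^] i \<otimes> h \<otimes> inv (g [^] i) \<in> H"
      using pow_norm [OF h] f by (simp add: g_def nat_pow_pow)
    show "g [^] i \<otimes> h = g [^] i \<otimes> h \<otimes> inv (g [^] i) \<otimes> g [^] i"
      using h g by (simp add: m_assoc)
  qed
  define K where "K = (\<lambda>(h, i::nat). h \<otimes> g [^] i) ` (H \<times> {..<p})"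
  have of_K: "\<exists>h\<in>H. \<exists>i::nat. x = h \<otimes> g [^] i" if "x \<in> K" for x
    using that by (auto simp: K_def)
  \<comment> \<open>The exponent may be reduced modulo \<open>p\<close>, because \<open>g^p\<close> lies in \<open>H\<close>.\<close>
  have in_K: "h \<otimes> g [^] i \<in> K" if "h \<in> H" for h and i :: nat
  proof -
    have "g [^] i = g [^] (p * (i div p)) \<otimes> g [^] (i mod p)"
      using g by (simp add: nat_pow_mult)
    then have "h \<otimes> g [^] i = (h \<otimes> g [^] (p * (i div p))) \<otimes> g [^] (i mod p)"
      using that g by (simp add: m_assoc)
    moreover have "h \<otimes> g [^] (p * (i div p)) \<in> H" "i mod p < p"
      using that g_pow \<open>p > 0\<close> by auto
    ultimately show ?thesis
      unfolding K_def by (intro image_eqI [of _ _ "(h \<otimes> g [^] (p * (i div p)), i mod p)"]) auto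
  qed
  have mult: "\<exists>h''\<in>H. (h \<otimes> g [^] i) \<otimes> (h' \<otimes> g [^] j) = h'' \<otimes> g [^] (i + j)"
    if h: "h \<in> H" "h' \<in> H" for h h' and i j :: nat
  proof -
    obtain h'' where h'': "h'' \<in> H" "g [^] i \<otimes> h' = h'' \<otimes> g [^] i"
      using norm [OF h(2)] by blast
    have "(h \<otimes> g [^] i) \<otimes> (h' \<otimes> g [^] j) = h \<otimes> (g [^] i \<otimes> h') \<otimes> g [^] j"
      using h g by (simp add: m_assoc)
    also have "\<dots> = (h \<otimes> h'') \<otimes> g [^] (i + j)"
      using h h'' g by (simp add: m_assoc flip: nat_pow_mult)
    finally show ?thesis using h h'' by blast
  qed
  have pow: "\<exists>h'\<in>H. (h \<otimes> g [^] i) [^] k = h' \<otimes> g [^] (i * k)" if "h \<in> H" for h and i k :: nat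
  proof (induction k)
    case 0
    show ?case using g by (intro bexI [of _ \<one>]) auto
  next
    case (Suc k)
    then obtain h' where h': "h' \<in> H" "(h \<otimes> g [^] i) [^] k = h' \<otimes> g [^] (i * k)"
      by blast
    then show ?case
      using mult [OF h'(1) that, of "i * k" i] by (simp add: add.commute)
  qed
  have Kc: "K \<subseteq> carrier G"
    using g by (auto simp: K_def)
  have K_mult: "x \<otimes> y \<in> K" if xy: "x \<in> K" "y \<in> K" for x y
  proof -
    obtain h i h' j where hi: "h \<in> H" "x = h \<otimes> g [^] (i::nat)" "h' \<in> H" "y = h' \<otimes> g [^] (j::nat)"
      using of_K [OF xy(1)] of_K [OF xy(2)] by blast
    then show ?thesis
      using mult [OF hi(1,3), of i j] in_K by auto
  qed
  have "subgroup K G"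
  proof (rule subgroupI)
    show "K \<subseteq> carrier G" by (rule Kc)
    show "K \<noteq> {}" using in_K [OF H.one_closed] by blast
    show "x \<otimes> y \<in> K" if "x \<in> K" "y \<in> K" for x y using K_mult that .
  next
    fix x assume x: "x \<in> K"
    then have xc: "x \<in> carrier G" using Kc by blast
    have "x [^] Suc k \<in> K" for k :: nat
      by (induction k) (use x xc K_mult in auto)
    moreover have "\<one> \<in> K"
      using in_K [OF H.one_closed, of 0] by simp
    ultimately have pw: "x [^] (k::nat) \<in> K" for k
      by (cases k) auto
    \<comment> \<open>In a finite group inverses are powers, so closure under multiplication suffices.\<close>
    have "x [^] (order G - 1) \<otimes> x = \<one>"
      using pow_order_eq_1 [OF xc] \<open>order G > 0\<close> xc
      by (metis Suc_diff_1 nat_pow_Suc)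
    then have "inv x = x [^] (order G - 1)"
      using xc by (simp add: inv_equality)
    then show "inv x \<in> K" using pw by simp
  qed
  moreover have "card K = p * card H"
  proof -
    have le: "i \<le> j" if "h \<in> H" "h' \<in> H" "i < p" "j < p" "h \<otimes> g [^] i = h' \<otimes> g [^] j"
      for h h' and i j :: nat
    proof (rule ccontr)
      assume "\<not> i \<le> j"
      then have i: "i = (i - j) + j" by simp
      have "(h \<otimes> g [^] (i - j)) \<otimes> g [^] j = h \<otimes> g [^] i"
        using that g \<open>\<not> i \<le> j\<close> by (simp add: m_assoc nat_pow_mult)
      also have "\<dots> = h' \<otimes> g [^] j" by fact
      finally have "h \<otimes> g [^] (i - j) = h'"
        using that g by simp
      then have "inv h \<otimes> (h \<otimes> g [^] (i - j)) \<in> H"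
        using that by simp
      then have "g [^] (i - j) \<in> H"
        using that g by (simp flip: m_assoc)
      then have "p dvd i - j" by (simp add: g_pow)
      then show False
        using that \<open>\<not> i \<le> j\<close> by (auto dest: dvd_imp_le)
    qed
    have "inj_on (\<lambda>(h, i::nat). h \<otimes> g [^] i) (H \<times> {..<p})"
    proof (rule inj_onI, clarify)
      fix h h' and i j :: nat
      assume *: "h \<in> H" "h' \<in> H" "i < p" "j < p" "h \<otimes> g [^] i = h' \<otimes> g [^] j"
      then have "i = j"
        using le [of h h' i j] le [of h' h j i] by simp
      then show "h = h' \<and> i = j" using * g by simp
    qed
    then show ?thesis
      by (simp add: K_def card_image card_cartesian_product)
  qed
  moreover have "x [^] p \<in> H" if x: "x \<in> K" for x
  proof -
    obtain h i where hi: "h \<in> H" "x = h \<otimes> g [^] (i::nat)"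
      using of_K [OF x] by blast
    then obtain h' where "h' \<in> H" "x [^] p = h' \<otimes> g [^] (i * p)"
      using pow by blast
    then show ?thesis
      using g_pow [of "i * p"] by simp
  qed
  ultimately show ?thesis using that by blast
qed

text \<open>
Iterating \<open>p_group_extend_subgroup\<close> from \<open>H\<close> for \<open>i\<close> steps, or until the chain reaches \<open>G\<close>, produces a subgroup all of whose
\<open>p^i\<close>-th powers lie in \<open>H\<close>.  The minimum accounts for a chain that stops early.
\<close>

lemma p_group_card_roots_ge:
  fixes G (structure) and p :: nat
  assumes "group G" "nilpotent G" "order G = p ^ a" "Factorial_Ring.prime p" and H: "subgroup H G"
  shows "min (p ^ i * card H) (order G) \<le> card {x \<in> carrier G. x [^] (p ^ i) \<in> H}"
proof -
  interpret group G by fact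
  have "p > 0" using assms(4) prime_gt_0_nat by blast
  then have "order G > 0" using assms(3) by simp
  then have fin: "finite (carrier G)" by (simp add: order_gt_0_iff_finite)
  have "\<exists>K. subgroup K G \<and> (card K = p ^ i * card H \<or> K = carrier G) \<and> (\<forall>x\<in>K. x [^] (p ^ i) \<in> H)"
  proof (induction i)
    case 0
    then show ?case using H subgroup.mem_carrier [OF H] by (intro exI [of _ H]) auto
  next
    case (Suc i)
    then obtain K where K: "subgroup K G" "card K = p ^ i * card H \<or> K = carrier G"
        "\<And>x. x \<in> K \<Longrightarrow> x [^] (p ^ i) \<in> H"
      by blast
    have step: "x [^] (p ^ Suc i) \<in> H" if "x \<in> carrier G" "x [^] p \<in> K" for x
      using K(3) [OF that(2)] that(1) by (simp add: nat_pow_pow)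
    show ?case
    proof (cases "K = carrier G")
      case True
      then show ?thesis
        using K(1) step by (intro exI [of _ K]) auto
    next
      case False
      then obtain L where L: "subgroup L G" "card L = p * card K" "\<And>x. x \<in> L \<Longrightarrow> x [^] p \<in> K"
        using p_group_extend_subgroup [OF assms(1-4) K(1)] by blast
      then show ?thesis
        using K(2) False step subgroup.mem_carrier [OF L(1)] by (intro exI [of _ L]) auto
    qed
  qed
  then obtain K where K: "subgroup K G" "card K = p ^ i * card H \<or> K = carrier G"
      "\<forall>x\<in>K. x [^] (p ^ i) \<in> H"
    by blast
  then have "min (p ^ i * card H) (order G) \<le> card K"
    by (auto simp: order_def)
  also have "card K \<le> card {x \<in> carrier G. x [^] (p ^ i) \<in> H}"
    by (intro card_mono) (use fin K subgroup.mem_carrier [OF K(1)] in auto)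
  finally show ?thesis .
qed

text \<open>
Relative orders are powers of \<open>p\<close>, so a bound \<open>t\<close> between \<open>p^i\<close> and \<open>p^(i+1)\<close> says no more than
the bound \<open>p^i\<close>, and among powers of \<open>p\<close> the order is divisibility.
\<close>

lemma relative_order_le_iff_of_prime_power_order:
  fixes G (structure) and p :: nat
  assumes "group G" "finite (carrier G)" "order G = p ^ a" "Factorial_Ring.prime p"
    and "subgroup H G" "x \<in> carrier G" and t: "p ^ i \<le> t" "t < p ^ Suc i"
  shows "relative_order G H x \<le> t \<longleftrightarrow> x [^] (p ^ i) \<in> H"
proof -
  interpret group G by fact
  have p1: "p > 1" using assms(4) prime_gt_1_nat by blast
  note ro = relative_order_dvd_iff(2) [OF assms(1,2,5,6)]
  have "relative_order G H x dvd p ^ a"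
    using assms pow_order_eq_1 [of x] subgroup.one_closed [OF assms(5)] by (simp flip: ro)
  then obtain e where e: "relative_order G H x = p ^ e"
    using assms(4) divides_primepow_nat by blast
  have "p ^ e \<le> t \<longleftrightarrow> e \<le> i"
  proof
    assume "p ^ e \<le> t"
    then have "p ^ e < p ^ Suc i" using t by simp
    then have "e < Suc i" using p1 by (metis power_less_imp_less_exp)
    then show "e \<le> i" by simp
  next
    assume "e \<le> i"
    then have "p ^ e \<le> p ^ i" using p1 by simp
    then show "p ^ e \<le> t" using t by simp
  qed
  also have "e \<le> i \<longleftrightarrow> p ^ e dvd p ^ i"
    using p1 by (simp add: dvd_power_iff_le)
  finally show ?thesis
    by (simp add: ro e)
qed

section \<open>Groups with few roots of unity\<close>

text \<open>
For finite groups this is equivalent to being cyclic.  In this form the property passes to subgroups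
trivially, and it is the upper bound that the comparison needs.
\<close>

definition few_roots_of_unity :: "('a, 'b) monoid_scheme \<Rightarrow> bool"
  where "few_roots_of_unity G \<longleftrightarrow>
    (\<forall>k>0. card {x \<in> carrier G. x [^]\<^bsub>G\<^esub> (k::nat) = \<one>\<^bsub>G\<^esub>} \<le> k)"

text \<open>
If \<open>x^k\<close> lies in \<open>L\<close>, then \<open>x\<close> is annihilated by the exponent \<open>k * card L\<close>.
\<close>

lemma card_roots_le:
  fixes C (structure)
  assumes "group C" "finite (carrier C)" "few_roots_of_unity C" "subgroup L C" "k > 0"
  shows "card {x \<in> carrier C. x [^] (k::nat) \<in> L} \<le> k * card L"
proof -
  interpret group C by fact
  have "card L > 0"
    using assms subgroup.finite_imp_card_positive by blast
  have "x [^] (k * card L) = \<one>" if "x \<in> carrier C" "x [^] k \<in> L" for x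
    using subgroup_pow_card [OF assms(1,2,4) that(2)] that by (simp add: nat_pow_pow)
  then have "card {x \<in> carrier C. x [^] k \<in> L} \<le> card {x \<in> carrier C. x [^] (k * card L) = \<one>}"
    by (intro card_mono) (use assms(2) in auto)
  also have "\<dots> \<le> k * card L"
    using assms(3,5) \<open>card L > 0\<close> unfolding few_roots_of_unity_def by simp
  finally show ?thesis .
qed

lemma few_roots_of_unity_subgroup:
  assumes "group C" "finite (carrier C)" "few_roots_of_unity C" "subgroup K C"
  shows "few_roots_of_unity (C\<lparr>carrier := K\<rparr>)"
  unfolding few_roots_of_unity_def
proof (intro allI impI)
  fix k :: nat assume "k > 0"
  have "card {x \<in> K. x [^]\<^bsub>C\<^esub> k = \<one>\<^bsub>C\<^esub>} \<le> card {x \<in> carrier C. x [^]\<^bsub>C\<^esub> k = \<one>\<^bsub>C\<^esub>}"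
    by (intro card_mono) (use assms subgroup.mem_carrier in auto)
  also have "\<dots> \<le> k"
    using assms(3) \<open>k > 0\<close> by (simp add: few_roots_of_unity_def)
  finally show "card {x \<in> carrier (C\<lparr>carrier := K\<rparr>). x [^]\<^bsub>C\<lparr>carrier := K\<rparr>\<^esub> k = \<one>\<^bsub>C\<lparr>carrier := K\<rparr>\<^esub>} \<le> k"
    using assms(1) by (simp add: group.is_monoid flip: monoid.nat_pow_consistent)
qed

section \<open>Comparing the sums\<close>

text \<open>
Double counting of the pairs \<open>(x, t)\<close> with \<open>t < u x\<close>.
\<close>

lemma sum_eq_sum_card_tails:
  fixes u :: "'a \<Rightarrow> nat"
  assumes "finite A" "\<And>x. x \<in> A \<Longrightarrow> u x < M"
  shows "sum u A = (\<Sum>t<M. card {x \<in> A. t < u x})"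
proof -
  have "sum u A = (\<Sum>x\<in>A. card {t \<in> {..<M}. t < u x})"
  proof (rule sum.cong)
    fix x assume "x \<in> A"
    then have "{t \<in> {..<M}. t < u x} = {..<u x}"
      using assms(2) by fastforce
    then show "u x = card {t \<in> {..<M}. t < u x}" by simp
  qed simp
  also have "\<dots> = (\<Sum>t<M. card {x \<in> A. t < u x})"
    by (rule sum_multicount_gen) (use assms(1) in auto)
  finally show ?thesis .
qed

lemma sum_le_if_tails_le:
  fixes u :: "'a \<Rightarrow> nat" and v :: "'b \<Rightarrow> nat"
  assumes "finite A" "finite B"
    and tails: "\<And>t. card {x \<in> A. t < u x} \<le> card {y \<in> B. t < v y}"
  shows "sum u A \<le> sum v B"
proof -
  define M where "M = Suc (Max (u ` A \<union> v ` B))"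
  have "u x < M" if "x \<in> A" for x
    unfolding M_def using assms(1,2) that by (auto simp: less_Suc_eq_le)
  moreover have "v y < M" if "y \<in> B" for y
    unfolding M_def using assms(1,2) that by (auto simp: less_Suc_eq_le)
  ultimately show ?thesis
    using assms by (simp add: sum_eq_sum_card_tails [of A u M] sum_eq_sum_card_tails [of B v M] sum_mono)
qed

text \<open>
For every bound \<open>t\<close>, at least as many elements of \<open>G\<close> as of \<open>C\<close> have relative order at most \<open>t\<close>:
for \<open>p^i \<le> t < p^(i+1)\<close> the number \<open>min (p^i * card H) (order G)\<close> separates the two counts.
\<close>

lemma psi_le_of_prime_power_order:
  fixes G :: "('a, 'c) monoid_scheme" and C :: "('b, 'd) monoid_scheme" and p :: nat
  assumes G: "group G" "nilpotent G" "order G = p ^ a" and p: "Factorial_Ring.prime p"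
    and H: "subgroup H G"
    and C: "group C" "few_roots_of_unity C" "order C = order G"
    and L: "subgroup L C" "card L = card H"
  shows "psi G H \<le> psi C L"
proof -
  interpret G: group G by fact
  interpret C: group C by fact
  have p1: "p > 1" using p prime_gt_1_nat by blast
  then have "order G > 0" using G(3) by simp
  then have finG: "finite (carrier G)" and finC: "finite (carrier C)"
    using C(3) G.order_gt_0_iff_finite C.order_gt_0_iff_finite by simp_all
  show ?thesis
    unfolding psi_def
  proof (rule sum_le_if_tails_le [OF finG finC])
    fix t
    let ?A = "{x \<in> carrier G. relative_order G H x \<le> t}" and ?B = "{y \<in> carrier C. relative_order C L y \<le> t}"
    have "card ?B \<le> card ?A"
    proof (cases "t = 0")
      case True
      then have "?B = {}"
        using relative_order_dvd_iff(1) [OF C(1) finC L(1)] by force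
      then show ?thesis by (simp only: card.empty)
    next
      case False
      then obtain i where i: "p ^ i \<le> t" "t < p ^ Suc i"
        using ex_power_ivl1 [of p t] p1 by auto
      have "?B = {y \<in> carrier C. y [^]\<^bsub>C\<^esub> (p ^ i) \<in> L}"
        using relative_order_le_iff_of_prime_power_order [OF C(1) finC _ p L(1) _ i] G(3) C(3) by auto
      then have "card ?B \<le> p ^ i * card L" "card ?B \<le> order C"
        using card_roots_le [OF C(1) finC C(2) L(1), of "p ^ i"] p1 card_mono [OF finC, of ?B]
        by (auto simp: order_def)
      then have "card ?B \<le> min (p ^ i * card H) (order G)"
        using L(2) C(3) by simp
      also have "\<dots> \<le> card {x \<in> carrier G. x [^]\<^bsub>G\<^esub> (p ^ i) \<in> H}"
        by (rule p_group_card_roots_ge [OF G p H])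
      also have "{x \<in> carrier G. x [^]\<^bsub>G\<^esub> (p ^ i) \<in> H} = ?A"
        using relative_order_le_iff_of_prime_power_order [OF G(1) finG G(3) p H _ i] by auto
      finally show ?thesis .
    qed
    moreover have "{x \<in> carrier G. t < relative_order G H x} = carrier G - ?A"
        "{y \<in> carrier C. t < relative_order C L y} = carrier C - ?B"
      by auto
    ultimately show "card {x \<in> carrier G. t < relative_order G H x} \<le> card {y \<in> carrier C. t < relative_order C L y}"
      using C(3) finG finC by (simp add: card_Diff_subset order_def)
  qed
qed

text \<open>
Used to recover the orders of the two pieces of a subgroup of a product from their product.
\<close>

lemma coprime_factor_unique:
  fixes u v u' v' :: nat
  assumes "coprime b c" "u dvd b" "u' dvd b" "v dvd c" "v' dvd c" "u * v = u' * v'"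
  shows "u = u'"
proof (rule dvd_antisym)
  have "coprime u v'" "coprime u' v"
    using assms coprime_divisors by blast+
  moreover have "u dvd u' * v'" "u' dvd u * v"
    by (simp_all flip: assms(6)) (simp add: assms(6))
  ultimately show "u dvd u'" "u' dvd u"
    by (simp_all add: coprime_dvd_mult_left_iff)
qed

text \<open>
The induction on the order of \<open>G\<close> splits off one prime.  The groups and subgroups are all generalized, because
the hypothesis is applied to the factors with their own carriers.
\<close>

lemma psi_le_of_few_roots_of_unity:
  fixes G :: "('a, 'c) monoid_scheme" and C :: "('b, 'd) monoid_scheme"
  assumes "group G" "finite (carrier G)" "nilpotent G" "subgroup H G"
    and "comm_group C" "few_roots_of_unity C" "order C = order G"
    and "subgroup L C" "card L = card H"
  shows "psi G H \<le> psi C L"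
  using assms
proof (induction "order G" arbitrary: G C H L rule: less_induct)
  case less
  interpret G: group G by fact
  interpret C: comm_group C by fact
  have pos: "order G > 0"
    using less.prems by (simp add: G.order_gt_0_iff_finite)
  then have finC: "finite (carrier C)"
    using less.prems(7) C.order_gt_0_iff_finite by simp
  show ?case
  proof (cases "\<exists>p a. Factorial_Ring.prime p \<and> order G = p ^ a")
    case True
    then obtain p a :: nat where "Factorial_Ring.prime p" "order G = p ^ a"
      by blast
    with less.prems C.is_group show ?thesis
      by (intro psi_le_of_prime_power_order)
  next
    case False
    have "order G \<noteq> 1"
    proof
      assume "order G = 1"
      then have "order G = 2 ^ 0" by simp
      then show False using False two_is_prime_nat by blast
    qed
    then obtain p :: nat where p: "Factorial_Ring.prime p" "p dvd order G"
      using prime_factor_nat by blast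
    obtain a c where ac: "order G = p ^ a * c" "\<not> p dvd c"
    proof (rule multiplicity_decompose' [of "order G" p])
      show "order G \<noteq> 0" using pos by simp
      show "\<not> is_unit p" using p(1) not_prime_unit by blast
    qed blast
    define b where "b = p ^ a"
    have c: "order G = b * c"
      using ac by (simp add: b_def)
    have cop: "coprime b c"
      using p ac by (simp add: b_def prime_imp_coprime)
    have "c \<noteq> 1"
    proof
      assume "c = 1"
      then have "order G = p ^ a" using ac by simp
      then show False using False p(1) by blast
    qed
    moreover have "b \<noteq> 1"
    proof
      assume "b = 1"
      then show False using p(2) ac(2) c by simp
    qed
    ultimately have smaller: "b < order G" "c < order G"
      using pos c by auto
    obtain P Q where PQ: "coprime_commuting_subgroups G P Q" "P <#>\<^bsub>G\<^esub> Q = carrier G" "card P = b" "card Q = c"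
      by (rule coprime_decomposition [OF less.prems(1,2) nilpotent_coprime_orders_commute c cop])
        (use less.prems in blast)+
    interpret GPQ: coprime_commuting_subgroups G P Q by (rule PQ)
    have "coprime_orders_commute C"
      by (simp add: coprime_orders_commute_def C.m_comm)
    then obtain R S where RS: "coprime_commuting_subgroups C R S" "R <#>\<^bsub>C\<^esub> S = carrier C" "card R = b" "card S = c"
      by (rule coprime_decomposition [OF C.is_group finC _ _ cop]) (use c less.prems(7) in auto)
    interpret CRS: coprime_commuting_subgroups C R S by (rule RS)
    note H = \<open>subgroup H G\<close> and L = \<open>subgroup L C\<close>
    have cardG: "card (H \<inter> K) dvd card K" if "subgroup K G" for K
      using card_subgroup_dvd [OF G.is_group G.subgroups_Inter_pair [OF H that] that] by simp
    have cardC: "card (L \<inter> K) dvd card K" if "subgroup K C" for K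
      using card_subgroup_dvd [OF C.is_group C.subgroups_Inter_pair [OF L that] that] by simp
    note div = cardG [OF GPQ.P.subgroup_axioms] cardG [OF GPQ.Q.subgroup_axioms]
      cardC [OF CRS.P.subgroup_axioms] cardC [OF CRS.Q.subgroup_axioms]
    have prod: "card (L \<inter> R) * card (L \<inter> S) = card (H \<inter> P) * card (H \<inter> Q)"
      using GPQ.card_subgroup_product [OF H PQ(2)]
        CRS.card_subgroup_product [OF L RS(2)] less.prems(9) by simp
    have eqP: "card (L \<inter> R) = card (H \<inter> P)"
      by (rule coprime_factor_unique [OF cop _ _ _ _ prod]) (use div PQ RS in simp_all)
    have eqQ: "card (L \<inter> S) = card (H \<inter> Q)"
      by (rule coprime_factor_unique [of c b _ _ "card (L \<inter> R)" "card (H \<inter> P)"])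
        (use div PQ RS cop prod in \<open>simp_all add: ac_simps\<close>)
    have IH: "psi (G\<lparr>carrier := K\<rparr>) (H \<inter> K) \<le> psi (C\<lparr>carrier := M\<rparr>) (L \<inter> M)"
      if K: "subgroup K G" and M: "subgroup M C" and card: "card K < order G" "card M = card K"
        "card (L \<inter> M) = card (H \<inter> K)" for K M
    proof (rule less.hyps)
      show "order (G\<lparr>carrier := K\<rparr>) < order G" "order (C\<lparr>carrier := M\<rparr>) = order (G\<lparr>carrier := K\<rparr>)"
        using card by (simp_all add: order_def)
      show "group (G\<lparr>carrier := K\<rparr>)" by (rule G.subgroup_imp_group [OF K])
      show "finite (carrier (G\<lparr>carrier := K\<rparr>))"
        using finite_subset [OF subgroup.subset [OF K] less.prems(2)] by simp
      show "nilpotent (G\<lparr>carrier := K\<rparr>)"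
        by (rule nilpotent_subgroup [OF less.prems(1,3) K])
      show "subgroup (H \<inter> K) (G\<lparr>carrier := K\<rparr>)"
        using G.subgroup_incl [OF G.subgroups_Inter_pair [OF H K] K] by simp
      show "comm_group (C\<lparr>carrier := M\<rparr>)"
        using C.subgroup_imp_group [OF M] subgroup.mem_carrier [OF M] C.m_comm
        by (intro group.group_comm_groupI) auto
      show "few_roots_of_unity (C\<lparr>carrier := M\<rparr>)"
        by (rule few_roots_of_unity_subgroup [OF C.is_group finC less.prems(6) M])
      show "subgroup (L \<inter> M) (C\<lparr>carrier := M\<rparr>)"
        using C.subgroup_incl [OF C.subgroups_Inter_pair [OF L M] M] by simp
    qed (rule card)
    have "psi (G\<lparr>carrier := P\<rparr>) (H \<inter> P) \<le> psi (C\<lparr>carrier := R\<rparr>) (L \<inter> R)"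
      by (rule IH) (use GPQ.P.subgroup_axioms CRS.P.subgroup_axioms PQ RS smaller eqP in simp_all)
    moreover have "psi (G\<lparr>carrier := Q\<rparr>) (H \<inter> Q) \<le> psi (C\<lparr>carrier := S\<rparr>) (L \<inter> S)"
      by (rule IH) (use GPQ.Q.subgroup_axioms CRS.Q.subgroup_axioms PQ RS smaller eqQ in simp_all)
    ultimately show ?thesis
      using GPQ.psi_product [OF H PQ(2)] CRS.psi_product [OF L RS(2)]
      by (simp add: mult_le_mono)
  qed
qed

section \<open>Cyclic groups\<close>

lemma finite_cyclic_generator:
  fixes C (structure)
  assumes "group C" "finite (carrier C)" "cyclic_group C"
  obtains g where "g \<in> carrier C" "group.ord C g = order C" "carrier C = (\<lambda>i. g [^] i) ` {..<order C}"
proof -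
  interpret group C by fact
  obtain g where g: "g \<in> carrier C" "carrier C = range (\<lambda>i::int. g [^] i)"
    using assms(3) by (auto simp: cyclic_group)
  then have gen: "generate C {g} = carrier C"
    using generate_pow [OF g(1)] by auto
  have ord: "ord g = order C"
    using generate_pow_card [OF g(1)] gen by (simp add: order_def)
  have "carrier C = {g [^] i | i. i \<in> {0..ord g - 1}}"
    unfolding gen [symmetric] generate_pow_on_finite_carrier [OF assms(2) g(1)]
    by (rule ord_elems [OF assms(2) g(1)])
  also have "{0..ord g - 1} = {..<order C}"
    using ord_ge_1 [OF assms(2) g(1)] ord by auto
  finally show thesis
    unfolding Setcompr_eq_image by (rule that [OF g(1) ord])
qed

text \<open>
If \<open>g\<close> generates a group of order \<open>n\<close> and \<open>x = g^j\<close> with \<open>j < n\<close>, then \<open>x^k = 1\<close> means \<open>j * k = n * t\<close>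
for some \<open>t\<close>.  Then \<open>t < k\<close>, and \<open>t\<close> determines \<open>j\<close>, so there are at most \<open>k\<close> such \<open>x\<close>.
\<close>

lemma cyclic_few_roots_of_unity:
  fixes C (structure)
  assumes "group C" "finite (carrier C)" "cyclic_group C"
  shows "few_roots_of_unity C"
  unfolding few_roots_of_unity_def
proof (intro allI impI)
  interpret group C by fact
  fix k :: nat assume "k > 0"
  define n where "n = order C"
  obtain g where g: "g \<in> carrier C" "ord g = n" "carrier C = (\<lambda>i. g [^] i) ` {..<n}"
    using finite_cyclic_generator [OF assms] unfolding n_def .
  have "{x \<in> carrier C. x [^] k = \<one>} \<subseteq> (\<lambda>t. g [^] (n * t div k)) ` {..<k}"
  proof clarify
    fix x assume x: "x \<in> carrier C" "x [^] k = \<one>"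
    then obtain j where j: "j < n" "x = g [^] j"
      using g(3) by auto
    have "n dvd j * k"
      using x(2) j(2) g(1) by (simp add: nat_pow_pow pow_eq_id g(2))
    then obtain t where t: "j * k = n * t" by blast
    then have "n * t < n * k" using j \<open>k > 0\<close> by (metis mult_less_mono1)
    then have "t < k" by simp
    moreover have "n * t div k = j" using t \<open>k > 0\<close> by (metis nonzero_mult_div_cancel_right neq0_conv)
    ultimately show "x \<in> (\<lambda>t. g [^] (n * t div k)) ` {..<k}"
      using j by blast
  qed
  then have "card {x \<in> carrier C. x [^] k = \<one>} \<le> card ((\<lambda>t. g [^] (n * t div k)) ` {..<k})"
    by (intro card_mono) auto
  also have "\<dots> \<le> k"
    using card_image_le [of "{..<k}"] by simp
  finally show "card {x \<in> carrier C. x [^] k = \<one>} \<le> k" .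
qed

text \<open>
The definite description denotes a subgroup because exactly one exists.  A power of a generator yields one; any
subgroup of order \<open>m\<close> consists of \<open>m\<close> of the at most \<open>m\<close> solutions of \<open>x^m = 1\<close>, so it is the set
of all of them.
\<close>

lemma the_subgroup_of_order_cyclic:
  fixes C (structure)
  assumes "group C" "finite (carrier C)" "cyclic_group C" "m dvd order C"
  shows "subgroup (the_subgroup_of_order C m) C" "card (the_subgroup_of_order C m) = m"
proof -
  interpret group C by fact
  have "order C > 0"
    using assms(2) by (simp add: order_gt_0_iff_finite)
  then have "m > 0" using assms(4) by (auto intro: Nat.gr0I)
  obtain d where d: "order C = m * d" using assms(4) by blast
  obtain g where g: "g \<in> carrier C" "ord g = order C"
    using finite_cyclic_generator [OF assms(1-3)] by metis
  have "\<exists>L. subgroup L C \<and> card L = m"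
  proof (intro exI conjI)
    show "subgroup (generate C {g [^] d}) C"
      using g by (intro generate_is_subgroup) auto
    show "card (generate C {g [^] d}) = m"
      using generate_pow_card [of "g [^] d"] ord_pow_gen [OF g(1), of d] g d \<open>order C > 0\<close> by simp
  qed
  moreover have "L = K" if "subgroup L C" "card L = m" "subgroup K C" "card K = m" for L K
  proof -
    let ?R = "{x \<in> carrier C. x [^] m = \<one>}"
    have "card ?R \<le> m"
      using cyclic_few_roots_of_unity [OF assms(1-3)] \<open>m > 0\<close> by (simp add: few_roots_of_unity_def)
    moreover have "M \<subseteq> ?R" if "subgroup M C" "card M = m" for M
      using subgroup_pow_card [OF assms(1,2) that(1)] subgroup.mem_carrier [OF that(1)] that(2) by auto
    ultimately have "M = ?R" if "subgroup M C" "card M = m" for M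
      using that assms(2) by (intro card_seteq) auto
    then show ?thesis using that by blast
  qed
  ultimately have "\<exists>!L. subgroup L C \<and> card L = m" by blast
  then have "subgroup (the_subgroup_of_order C m) C \<and> card (the_subgroup_of_order C m) = m"
    unfolding the_subgroup_of_order_def by (rule theI')
  then show "subgroup (the_subgroup_of_order C m) C" "card (the_subgroup_of_order C m) = m"
    by auto
qed

theorem theorem1p1:
  fixes G :: "('a, 'c) monoid_scheme" and C :: "('b, 'd) monoid_scheme"
    and H :: "'a set" and n m :: nat
  assumes "group G" and "finite (carrier G)" and "nilpotent G" and "order G = n"
    and "subgroup H G" and "card H = m"
    and "group C" and "cyclic_group C" and "order C = n"
  shows "psi G H \<le> psi C (the_subgroup_of_order C m)"
proof -
  interpret G: group G by fact
  interpret C: group C by fact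
  have "order G > 0"
    using assms(2) by (simp add: G.order_gt_0_iff_finite)
  then have finC: "finite (carrier C)"
    using assms(4,9) C.order_gt_0_iff_finite by simp
  have "m dvd order C"
    using card_subgroup_dvd [OF assms(1,5) G.subgroup_self subgroup.subset [OF assms(5)]] assms
    by (simp add: order_def)
  note L = the_subgroup_of_order_cyclic [OF assms(7) finC assms(8) this]
  show ?thesis
    by (rule psi_le_of_few_roots_of_unity)
      (use assms L finC cyclic_few_roots_of_unity C.cyclic_imp_abelian_group in auto)
qed

end
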